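(* If $G=(A,B,E(G))$ is a connected, bipartite graph, then $n(G)\le \mathrm{gp}(G\overline{G})\le n(G)+1$. Moreover, $\mathrm{gp}(G\overline{G})=n(G)+1$ if and only if $\mathrm{rad}(G)=2$ and $C(G)$ is an independent set.
   Context: Graphs are finite and simple; $n(G)$ is the number of vertices of $G$ and $\overline{G}$ is the complement of $G$. Writing $G=(A,B,E(G))$ means that $G$ is bipartite with bipartition $V(G)=A\cup B$. The complementary prism $G\overline{G}$ is the graph formed from the disjoint union of $G$ and $\overline{G}$ by adding, for each $u\in V(G)$, an edge between $u$ and the corresponding vertex $\overline{u}$ of $\overline{G}$. A geodesic is a shortest path between its two end vertices. A set $S$ of vertices of a graph $H$ is a general position set if no element of $S$ lies on a geodesic of $H$ between two other elements of $S$; $\mathrm{gp}(H)$ is the maximum cardinality of a general position set of $H$. With $d_G$ the usual shortest-path distance in $G$, the eccentricity of $u$ is $\mathrm{ecc}_G(u)=\max\{d_G(u,v): v\in V(G)\}$, $\mathrm{rad}(G)=\min\{\mathrm{ecc}_G(v): v\in V(G)\}$, and $C(G)=\{v\in V(G): \mathrm{ecc}_G(v)=\mathrm{rad}(G)\}$ is the set of central vertices.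
   Formalization: The equivalence is claimed only for n(G) ≠ 1, since it fails for the one-vertex graph, where gp of the complementary prism is 2 = n(G)+1 but rad(G) = 0; the bounds n(G) ≤ gp ≤ n(G)+1 still include that graph. *)

theory Defs
  imports "Graph_Theory.Graph_Theory"
begin

text \<open>
  A finite simple graph is a \<^locale>\<open>pair_graph\<close>: each edge uv is represented by the two arcs
  (u, v) and (v, u).
\<close>

text \<open>
  A part may be empty, so the one-vertex graph is bipartite. Its complementary prism is a single
  edge, which has general position number 2 = 1 + 1, while its radius is 0; an equivalence between
  gp = n + 1 and a condition forcing radius 2 therefore has to exclude it.
\<close>

definition bipartition :: "'a pair_pre_digraph \<Rightarrow> 'a set \<Rightarrow> 'a set \<Rightarrow> bool" where
  "bipartition G A B \<longleftrightarrow>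
     A \<union> B = pverts G \<and> A \<inter> B = {} \<and> parcs G \<subseteq> A \<times> B \<union> B \<times> A"

definition independent_set :: "'a pair_pre_digraph \<Rightarrow> 'a set \<Rightarrow> bool" where
  "independent_set G S \<longleftrightarrow> S \<subseteq> pverts G \<and> (\<forall>u\<in>S. \<forall>v\<in>S. (u, v) \<notin> parcs G)"

definition complement_graph :: "'a pair_pre_digraph \<Rightarrow> 'a pair_pre_digraph" where
  "complement_graph G =
     \<lparr>pverts = pverts G,
      parcs = {(u, v). u \<in> pverts G \<and> v \<in> pverts G \<and> u \<noteq> v \<and> (u, v) \<notin> parcs G}\<rparr>"

text \<open>
  \<^term>\<open>Inl u\<close> is the vertex u of G, and \<^term>\<open>Inr u\<close> is the corresponding vertex
  of the complement.
\<close>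

definition complementary_prism :: "'a pair_pre_digraph \<Rightarrow> ('a + 'a) pair_pre_digraph" where
  "complementary_prism G =
     \<lparr>pverts = pverts G <+> pverts (complement_graph G),
      parcs = {(Inl u, Inl v) | u v. (u, v) \<in> parcs G}
            \<union> {(Inr u, Inr v) | u v. (u, v) \<in> parcs (complement_graph G)}
            \<union> {(Inl u, Inr u) | u. u \<in> pverts G}
            \<union> {(Inr u, Inl u) | u. u \<in> pverts G}\<rparr>"

text \<open>
  The shortest-path distance is the library's minimum walk cost for unit arc weights; it is
  infinite between vertices of different components.
\<close>

definition graph_dist :: "'a pair_pre_digraph \<Rightarrow> 'a \<Rightarrow> 'a \<Rightarrow> ereal" where
  "graph_dist G u v = wf_digraph.\<mu> (with_proj G) (\<lambda>_. 1) u v"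

definition geodesic :: "'a pair_pre_digraph \<Rightarrow> 'a \<Rightarrow> ('a \<times> 'a) awalk \<Rightarrow> 'a \<Rightarrow> bool" where
  "geodesic G u p v \<longleftrightarrow>
     pre_digraph.apath (with_proj G) u p v \<and> ereal (real (length p)) = graph_dist G u v"

definition general_position_set :: "'a pair_pre_digraph \<Rightarrow> 'a set \<Rightarrow> bool" where
  "general_position_set G S \<longleftrightarrow> S \<subseteq> pverts G \<and>
     \<not> (\<exists>x\<in>S. \<exists>u\<in>S. \<exists>v\<in>S. x \<noteq> u \<and> x \<noteq> v \<and> u \<noteq> v \<and>
          (\<exists>p. geodesic G u p v \<and> x \<in> set (pre_digraph.awalk_verts (with_proj G) u p)))"

definition gp :: "'a pair_pre_digraph \<Rightarrow> nat" where
  "gp G = Max {card S | S. general_position_set G S}"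

definition ecc :: "'a pair_pre_digraph \<Rightarrow> 'a \<Rightarrow> ereal" where
  "ecc G u = Max {graph_dist G u v | v. v \<in> pverts G}"

definition rad :: "'a pair_pre_digraph \<Rightarrow> ereal" where
  "rad G = Min {ecc G v | v. v \<in> pverts G}"

definition center :: "'a pair_pre_digraph \<Rightarrow> 'a set" where
  "center G = {v \<in> pverts G. ecc G v = rad G}"

lemma pair_graph_complement_graph:
  assumes "pair_graph G"
  shows "pair_graph (complement_graph G)"
proof -
  interpret pair_graph G by fact
  have fin: "finite (pverts G)" by simp
  have "finite {(u, v). u \<in> pverts G \<and> v \<in> pverts G \<and> u \<noteq> v \<and> (u, v) \<notin> parcs G}"
    by (rule finite_subset[of _ "pverts G \<times> pverts G"]) (auto simp: fin)
  moreover have "(u, v) \<in> parcs G \<longleftrightarrow> (v, u) \<in> parcs G" for u v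
    using arcs_symmetric by blast
  ultimately show ?thesis
    by unfold_locales
       (auto simp: complement_graph_def fin symmetric_def arcs_ends_conv intro!: symI)
qed

lemma pair_graph_complementary_prism:
  assumes "pair_graph G"
  shows "pair_graph (complementary_prism G)"
proof -
  interpret G: pair_graph G by fact
  interpret C: pair_graph "complement_graph G" using assms by (rule pair_graph_complement_graph)
  have [simp]: "pverts (complement_graph G) = pverts G" by (simp add: complement_graph_def)
  let ?P = "complementary_prism G"
  have V: "finite (pverts ?P)" by (simp add: complementary_prism_def)
  have sub: "parcs ?P \<subseteq> pverts ?P \<times> pverts ?P"
    using G.in_arcsD1 G.in_arcsD2 C.in_arcsD1 C.in_arcsD2
    by (auto simp: complementary_prism_def)
  have E: "finite (parcs ?P)"
    using sub V by (meson finite_SigmaI finite_subset)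
  have loop: "fst e \<noteq> snd e" if "e \<in> parcs ?P" for e
    using that G.no_loops C.no_loops by (auto simp: complementary_prism_def)
  have sym: "(v, u) \<in> parcs ?P" if "(u, v) \<in> parcs ?P" for u v
    using that G.arcs_symmetric C.arcs_symmetric by (auto simp: complementary_prism_def)
  show ?thesis
    using V E sub loop sym
    by unfold_locales (auto simp: symmetric_def arcs_ends_conv intro!: symI)
qed

end

theory Submission
  imports Defs
begin

text \<open>
  In the complementary prism, u and its copy are adjacent, so a general position set S contains
  both copies of at most one vertex: if both copies of u and of v were in S, then the geodesic of
  length 2 from u to the copy of v that passes through the copy of u (if u and v are not adjacent)
  or through v (if they are) would contain three points of S. Hence gp is at most n + 1, while
  A together with the copies of B is a general position set of size n.

  If S has size n + 1 and contains both copies of w, then the neighbours of w occur in S only as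
  copies and all other vertices only as originals. For w in A, a vertex at distance 3 from w in G
  would make the vertex before it on a geodesic from w an inner point, so w is adjacent to all of
  B; and a vertex b of B adjacent to all of A would put w on a geodesic of length 3 from the copy
  of w to the copy of b. Conversely, under these two conditions the copy of w can be added to A and
  the copies of B. Both conditions are about vertices of eccentricity at most 2: there is one, and
  no two of them are adjacent.
\<close>

context pair_graph begin

section \<open>Distances and geodesics in a finite graph\<close>

lemma awalk_cost_unit: "awalk_cost (\<lambda>_. 1) p = real (length p)"
  by (induction p) auto

lemma graph_dist_le_length: "awalk u p v \<Longrightarrow> graph_dist G u v \<le> ereal (real (length p))"
  unfolding graph_dist_def by (metis min_cost_le_walk_cost awalk_cost_unit)

lemma geodesic_exists:
  assumes "u \<rightarrow>\<^sup>*\<^bsub>with_proj G\<^esub> v"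
  obtains p where "geodesic G u p v"
proof -
  obtain p where "apath u p v" "\<mu> (\<lambda>_. 1) u v = awalk_cost (\<lambda>_. 1) p"
    using min_cost_awalk[OF assms, of "\<lambda>_. 1"] by auto
  then show thesis
    by (intro that[of p]) (simp add: geodesic_def graph_dist_def awalk_cost_unit)
qed

lemma graph_dist_eq_infinity: "\<not> u \<rightarrow>\<^sup>*\<^bsub>with_proj G\<^esub> v \<Longrightarrow> graph_dist G u v = \<infinity>"
  unfolding graph_dist_def by (rule shortest_path_inf)

lemma graph_dist_cases:
  obtains "graph_dist G u v = \<infinity>" "\<not> u \<rightarrow>\<^sup>*\<^bsub>with_proj G\<^esub> v"
  | p where "geodesic G u p v" "awalk u p v" "graph_dist G u v = ereal (real (length p))"
  using geodesic_exists graph_dist_eq_infinity unfolding geodesic_def apath_def by metis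

lemma graph_dist_le_iff:
  "graph_dist G u v \<le> ereal (real k) \<longleftrightarrow> (\<exists>p. awalk u p v \<and> length p \<le> k)"
proof
  assume "graph_dist G u v \<le> ereal (real k)"
  then show "\<exists>p. awalk u p v \<and> length p \<le> k"
    by (cases u v rule: graph_dist_cases) auto
next
  assume "\<exists>p. awalk u p v \<and> length p \<le> k"
  then show "graph_dist G u v \<le> ereal (real k)"
    by (meson graph_dist_le_length ereal_less_eq(3) of_nat_le_iff order_trans)
qed

lemma graph_dist_le_0_iff: "graph_dist G u v \<le> 0 \<longleftrightarrow> u = v \<and> u \<in> pverts G"
  using graph_dist_le_iff[of u v 0] by (simp add: awalk_Nil_iff zero_ereal_def)

text \<open>Splitting off the first arc of a walk gives a recursion that turns the bounds 1, 2 and 3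
  into adjacency conditions.\<close>

lemma graph_dist_le_Suc_iff:
  "graph_dist G u v \<le> ereal (real (Suc k)) \<longleftrightarrow>
     u = v \<and> u \<in> pverts G \<or> (\<exists>w. (u, w) \<in> parcs G \<and> graph_dist G w v \<le> ereal (real k))"
  (is "?L \<longleftrightarrow> ?R")
proof
  assume ?L
  then obtain p where p: "awalk u p v" "length p \<le> Suc k"
    by (auto simp: graph_dist_le_iff simp del: of_nat_Suc)
  then show ?R
    by (cases p) (auto simp: awalk_simps graph_dist_le_iff)
next
  assume ?R
  then show ?L
  proof (elim disjE exE conjE)
    fix w assume w: "(u, w) \<in> parcs G" "graph_dist G w v \<le> ereal (real k)"
    then obtain p where "awalk w p v" "length p \<le> k" by (auto simp: graph_dist_le_iff)
    then show ?L using w(1)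
      by (subst graph_dist_le_iff) (auto intro!: exI[of _ "(u, w) # p"] simp: awalk_simps)
  qed (use graph_dist_le_iff[of u v "Suc k"] in \<open>auto intro: exI[of _ "[]"] simp: awalk_simps\<close>)
qed

lemma graph_dist_le_1_iff:
  "graph_dist G u v \<le> 1 \<longleftrightarrow> u = v \<and> u \<in> pverts G \<or> (u, v) \<in> parcs G"
  using graph_dist_le_Suc_iff[of u v 0] in_arcsD2
  by (auto simp: graph_dist_le_0_iff simp flip: zero_ereal_def one_ereal_def)

text \<open>The simplifier normalises \<^term>\<open>2 :: ereal\<close> to \<^term>\<open>ereal 2\<close>.\<close>

lemma graph_dist_le_2_iff:
  "graph_dist G u v \<le> ereal 2 \<longleftrightarrow> u = v \<and> u \<in> pverts G \<or> (u, v) \<in> parcs G \<or>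
     (\<exists>w. (u, w) \<in> parcs G \<and> (w, v) \<in> parcs G)"
  using graph_dist_le_Suc_iff[of u v 1] in_arcsD2
  by (auto simp: graph_dist_le_1_iff simp flip: one_ereal_def)

lemma graph_dist_le_3_iff:
  "graph_dist G u v \<le> ereal 3 \<longleftrightarrow> graph_dist G u v \<le> ereal 2 \<or>
     (\<exists>w x. (u, w) \<in> parcs G \<and> (w, x) \<in> parcs G \<and> (x, v) \<in> parcs G)"
proof -
  have "graph_dist G u v \<le> ereal 3 \<longleftrightarrow>
      u = v \<and> u \<in> pverts G \<or> (\<exists>w. (u, w) \<in> parcs G \<and> graph_dist G w v \<le> ereal 2)"
    using graph_dist_le_Suc_iff[of u v 2] by simp
  then show ?thesis
    unfolding graph_dist_le_2_iff using in_arcsD2 by metis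
qed

text \<open>Holds because a distance is a natural number or infinite, so no value lies strictly
  between k and k + 1.\<close>

lemma graph_dist_eq_iff:
  "graph_dist G u v = ereal (real (Suc k)) \<longleftrightarrow>
     graph_dist G u v \<le> ereal (real (Suc k)) \<and> \<not> graph_dist G u v \<le> ereal (real k)"
  by (cases u v rule: graph_dist_cases) auto

lemma graph_dist_eq_0_iff: "graph_dist G u v = 0 \<longleftrightarrow> u = v \<and> u \<in> pverts G"
  by (subst graph_dist_le_0_iff[symmetric]) (cases u v rule: graph_dist_cases; auto)

lemma graph_dist_eq_1_iff: "graph_dist G u v = 1 \<longleftrightarrow> (u, v) \<in> parcs G"
proof -
  have "graph_dist G u v = 1 \<longleftrightarrow> graph_dist G u v \<le> 1 \<and> \<not> graph_dist G u v \<le> 0"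
    using graph_dist_eq_iff[of u v 0] by (simp add: one_ereal_def zero_ereal_def)
  then show ?thesis
    using no_loops' in_arcsD1 by (auto simp: graph_dist_le_0_iff graph_dist_le_1_iff)
qed

lemma graph_dist_eq_2_iff:
  "graph_dist G u v = ereal 2 \<longleftrightarrow>
     u \<noteq> v \<and> (u, v) \<notin> parcs G \<and> (\<exists>w. (u, w) \<in> parcs G \<and> (w, v) \<in> parcs G)"
proof -
  have "graph_dist G u v = ereal 2 \<longleftrightarrow> graph_dist G u v \<le> ereal 2 \<and> \<not> graph_dist G u v \<le> 1"
    using graph_dist_eq_iff[of u v 1] by (simp add: one_ereal_def)
  then show ?thesis
    using in_arcsD1 by (auto simp: graph_dist_le_2_iff graph_dist_le_1_iff)
qed

lemma graph_dist_eq_3_iff: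
  "graph_dist G u v = ereal 3 \<longleftrightarrow> \<not> graph_dist G u v \<le> ereal 2 \<and>
     (\<exists>w x. (u, w) \<in> parcs G \<and> (w, x) \<in> parcs G \<and> (x, v) \<in> parcs G)"
proof -
  have "graph_dist G u v = ereal 3 \<longleftrightarrow> graph_dist G u v \<le> ereal 3 \<and> \<not> graph_dist G u v \<le> ereal 2"
    using graph_dist_eq_iff[of u v 2] by simp
  then show ?thesis by (auto simp: graph_dist_le_3_iff)
qed

text \<open>A geodesic splits at x into two walks, and the triangle inequality makes the split
  exact; conversely, shortest walks to and from x concatenate. Finiteness has to be demanded:
  between different components both sides of the equation are infinite for every x.\<close>

lemma geodesic_through_iff:
  "(\<exists>p. geodesic G u p v \<and> x \<in> set (awalk_verts u p)) \<longleftrightarrow>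
     graph_dist G u v \<noteq> \<infinity> \<and> graph_dist G u x + graph_dist G x v = graph_dist G u v"
  (is "?L \<longleftrightarrow> ?R")
proof
  assume ?L
  then obtain p where p: "awalk u p v" "graph_dist G u v = ereal (real (length p))"
    "x \<in> set (awalk_verts u p)"
    by (auto simp: geodesic_def apath_def)
  obtain q r where qr: "p = q @ r" "awalk u q x" "awalk x r v"
    using awalk_decomp[OF p(1,3)] by blast
  have "graph_dist G u x + graph_dist G x v \<le> graph_dist G u v"
    using add_mono[OF graph_dist_le_length[OF qr(2)] graph_dist_le_length[OF qr(3)]] p qr(1) by simp
  moreover have "graph_dist G u v \<le> graph_dist G u x + graph_dist G x v"
  proof (cases u x rule: graph_dist_cases)
    case (2 s)
    show ?thesis
    proof (cases x v rule: graph_dist_cases)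
      case t: (2 t)
      show ?thesis
        using graph_dist_le_length[OF awalk_appendI[OF 2(2) t(2)]]
          2(3) t(3) by simp
    qed simp
  qed simp
  ultimately have "graph_dist G u x + graph_dist G x v = graph_dist G u v"
    by (rule antisym)
  then show ?R by (simp only:) (simp add: p(2))
next
  assume R: ?R
  then have "graph_dist G u x + graph_dist G x v \<noteq> \<infinity>" by simp
  then have "graph_dist G u x \<noteq> \<infinity>" "graph_dist G x v \<noteq> \<infinity>"
    by simp_all
  then obtain s t where s: "awalk u s x" "graph_dist G u x = ereal (real (length s))"
    and t: "awalk x t v" "graph_dist G x v = ereal (real (length t))"
    by (cases u x rule: graph_dist_cases; cases x v rule: graph_dist_cases) simp_all
  have st: "awalk u (s @ t) v" using s t by (auto intro: awalk_appendI)
  have len: "graph_dist G u v = ereal (real (length (s @ t)))" using R s t by simp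
  \<comment> \<open>A repeated vertex would allow a nonempty closed walk to be cut out, leaving a
    walk shorter than the distance.\<close>
  have "distinct (awalk_verts u (s @ t))"
  proof (rule ccontr)
    assume "\<not> distinct (awalk_verts u (s @ t))"
    then obtain a b c y where abc: "s @ t = a @ b @ c" "distinct (awalk_verts u a)" "0 < length b"
       "awalk u a y" "awalk y b y" "awalk y c v"
      using awalk_not_distinct_decomp[OF st] by blast
    then have "awalk u (a @ c) v" by (auto intro: awalk_appendI)
    then have "length (s @ t) \<le> length (a @ c)"
      using graph_dist_le_length[of u "a @ c" v] len by simp
    then show False using abc(1,3) by simp
  qed
  moreover have "x \<in> set (awalk_verts u (s @ t))"
    using s t st by (auto simp: set_awalk_verts_append)
  ultimately have "geodesic G u (s @ t) v \<and> x \<in> set (awalk_verts u (s @ t))"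
    using st len by (simp only: geodesic_def apath_def simp_thms)
  then show ?L ..
qed

lemma general_position_set_iff:
  "general_position_set G S \<longleftrightarrow> S \<subseteq> pverts G \<and>
     \<not> (\<exists>x\<in>S. \<exists>u\<in>S. \<exists>v\<in>S. x \<noteq> u \<and> x \<noteq> v \<and> u \<noteq> v \<and>
        graph_dist G u v \<noteq> \<infinity> \<and>
        graph_dist G u x + graph_dist G x v = graph_dist G u v)"
  by (simp only: general_position_set_def awalk_verts_with_proj_eq geodesic_through_iff)

section \<open>Distances and general position in the complementary prism\<close>

lemma in_parcs_prism [simp]:
  "(Inl u, Inl v) \<in> parcs (complementary_prism G) \<longleftrightarrow> (u, v) \<in> parcs G"
  "(Inr u, Inr v) \<in> parcs (complementary_prism G) \<longleftrightarrow>
     u \<in> pverts G \<and> v \<in> pverts G \<and> u \<noteq> v \<and> (u, v) \<notin> parcs G"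
  "(Inl u, Inr v) \<in> parcs (complementary_prism G) \<longleftrightarrow> u = v \<and> u \<in> pverts G"
  "(Inr u, Inl v) \<in> parcs (complementary_prism G) \<longleftrightarrow> u = v \<and> u \<in> pverts G"
  by (auto simp: complementary_prism_def complement_graph_def)

lemma pverts_prism: "pverts (complementary_prism G) = pverts G <+> pverts G"
  by (simp add: complementary_prism_def complement_graph_def)

text \<open>
  Distances in the prism never exceed 3, because two originals are joined through their copies and
  two copies through their originals.
\<close>

fun prism_dist :: "'a + 'a \<Rightarrow> 'a + 'a \<Rightarrow> nat" where
  "prism_dist (Inl u) (Inl v) =
     (if u = v then 0 else if (u, v) \<in> parcs G then 1
      else if \<exists>w. (u, w) \<in> parcs G \<and> (w, v) \<in> parcs G then 2 else 3)"
| "prism_dist (Inr u) (Inr v) =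
     (if u = v then 0 else if (u, v) \<notin> parcs G then 1
      else if \<exists>w\<in>pverts G. w \<noteq> u \<and> w \<noteq> v \<and> (u, w) \<notin> parcs G \<and> (w, v) \<notin> parcs G then 2 else 3)"
| "prism_dist (Inl u) (Inr v) = (if u = v then 1 else 2)"
| "prism_dist (Inr u) (Inl v) = (if u = v then 1 else 2)"

text \<open>The halves are joined only by arcs between a vertex and its own copy. Hence two distinct
  vertices of one half can have a common neighbour only in that half, and if they are neither
  adjacent nor have one, crossing over and back takes 3 steps. An original and the copy of another
  vertex are joined in 2 steps, through G or through the complement according to adjacency.\<close>

lemma graph_dist_prism:
  assumes "x \<in> pverts (complementary_prism G)" "y \<in> pverts (complementary_prism G)"
  shows "graph_dist (complementary_prism G) x y = ereal (real (prism_dist x y))"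
proof -
  interpret P: pair_graph "complementary_prism G"
    by (rule pair_graph_complementary_prism) (rule pair_graph_axioms)
  have eqs: "prism_dist x y = 0 \<Longrightarrow> x = y \<Longrightarrow> ?thesis"
    "prism_dist x y = 1 \<Longrightarrow> (x, y) \<in> parcs (complementary_prism G) \<Longrightarrow> ?thesis"
    using assms P.graph_dist_eq_0_iff[of x y] P.graph_dist_eq_1_iff[of x y]
    by (simp_all add: one_ereal_def zero_ereal_def)
  have eq2: ?thesis if "prism_dist x y = 2" "x \<noteq> y" "(x, y) \<notin> parcs (complementary_prism G)"
    "(x, z) \<in> parcs (complementary_prism G)" "(z, y) \<in> parcs (complementary_prism G)" for z
    using that P.graph_dist_eq_2_iff[of x y] by auto
  have eq3: ?thesis if "prism_dist x y = 3" "x \<noteq> y" "(x, y) \<notin> parcs (complementary_prism G)"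
    "\<nexists>z. (x, z) \<in> parcs (complementary_prism G) \<and> (z, y) \<in> parcs (complementary_prism G)"
    "(x, z) \<in> parcs (complementary_prism G)" "(z, z') \<in> parcs (complementary_prism G)"
    "(z', y) \<in> parcs (complementary_prism G)" for z z'
    using that P.graph_dist_eq_3_iff[of x y] P.graph_dist_le_2_iff[of x y] by auto
  show ?thesis
  proof (cases x; cases y)
    fix u v assume xy: "x = Inl u" "y = Inl v"
    then have V: "u \<in> pverts G" "v \<in> pverts G" using assms by (auto simp: pverts_prism)
    consider "u = v" | "u \<noteq> v" "(u, v) \<in> parcs G"
      | w where "u \<noteq> v" "(u, v) \<notin> parcs G" "(u, w) \<in> parcs G" "(w, v) \<in> parcs G"
      | "u \<noteq> v" "(u, v) \<notin> parcs G" "\<nexists>w. (u, w) \<in> parcs G \<and> (w, v) \<in> parcs G"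
      by blast
    then show ?thesis
    proof cases
      case 1 then show ?thesis by (intro eqs(1)) (simp_all add: xy)
    next
      case 2 then show ?thesis by (intro eqs(2)) (simp_all add: xy)
    next
      case 3
      then have "prism_dist x y = 2" by (auto simp: xy)
      with 3 show ?thesis by (intro eq2[of "Inl w"]) (simp_all add: xy del: prism_dist.simps)
    next
      case 4
      then have "prism_dist x y = 3" by (auto simp: xy)
      moreover have "\<nexists>z. (x, z) \<in> parcs (complementary_prism G) \<and> (z, y) \<in> parcs (complementary_prism G)"
        using 4 by (auto simp: xy split_sum_ex)
      ultimately show ?thesis using 4 V
        by (intro eq3[of "Inr u" "Inr v"]) (simp_all add: xy del: prism_dist.simps)
    qed
  next
    fix u v assume xy: "x = Inr u" "y = Inr v"
    then have V: "u \<in> pverts G" "v \<in> pverts G" using assms by (auto simp: pverts_prism)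
    consider "u = v" | "u \<noteq> v" "(u, v) \<notin> parcs G"
      | w where "u \<noteq> v" "(u, v) \<in> parcs G" "w \<in> pverts G" "w \<noteq> u" "w \<noteq> v"
        "(u, w) \<notin> parcs G" "(w, v) \<notin> parcs G"
      | "u \<noteq> v" "(u, v) \<in> parcs G"
        "\<nexists>w. w \<in> pverts G \<and> w \<noteq> u \<and> w \<noteq> v \<and> (u, w) \<notin> parcs G \<and> (w, v) \<notin> parcs G"
      by blast
    then show ?thesis
    proof cases
      case 1 then show ?thesis by (intro eqs(1)) (simp_all add: xy)
    next
      case 2 with V show ?thesis by (intro eqs(2)) (simp_all add: xy)
    next
      case 3
      then have "prism_dist x y = 2" by (auto simp: xy)
      with 3 V show ?thesis
        by (intro eq2[of "Inr w"]) (simp_all add: xy del: prism_dist.simps)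
    next
      case 4
      then have "prism_dist x y = 3" by (auto simp: xy)
      moreover have "\<nexists>z. (x, z) \<in> parcs (complementary_prism G) \<and> (z, y) \<in> parcs (complementary_prism G)"
        using 4 by (auto simp: xy split_sum_ex)
      ultimately show ?thesis using 4 V
        by (intro eq3[of "Inl u" "Inl v"]) (simp_all add: xy del: prism_dist.simps)
    qed
  next
    fix u v assume xy: "x = Inl u" "y = Inr v"
    then have V: "u \<in> pverts G" "v \<in> pverts G" using assms by (auto simp: pverts_prism)
    consider "u = v" | "u \<noteq> v" "(u, v) \<in> parcs G" | "u \<noteq> v" "(u, v) \<notin> parcs G" by blast
    then show ?thesis
    proof cases
      case 1 with V show ?thesis by (intro eqs(2)) (simp_all add: xy)
    next
      case 2 with V show ?thesis by (intro eq2[of "Inl v"]) (simp_all add: xy)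
    next
      case 3 with V show ?thesis by (intro eq2[of "Inr u"]) (simp_all add: xy)
    qed
  next
    fix u v assume xy: "x = Inr u" "y = Inl v"
    then have V: "u \<in> pverts G" "v \<in> pverts G" using assms by (auto simp: pverts_prism)
    consider "u = v" | "u \<noteq> v" "(u, v) \<in> parcs G" | "u \<noteq> v" "(u, v) \<notin> parcs G" by blast
    then show ?thesis
    proof cases
      case 1 with V show ?thesis by (intro eqs(2)) (simp_all add: xy)
    next
      case 2 with V show ?thesis by (intro eq2[of "Inl u"]) (simp_all add: xy)
    next
      case 3 with V show ?thesis by (intro eq2[of "Inr v"]) (simp_all add: xy)
    qed
  qed
qed

text \<open>All distances in the prism are finite, so betweenness becomes an equation between
  natural numbers.\<close>

lemma general_position_set_prism_iff:
  "general_position_set (complementary_prism G) S \<longleftrightarrow> S \<subseteq> pverts G <+> pverts G \<and>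
     (\<forall>x\<in>S. \<forall>u\<in>S. \<forall>v\<in>S. x \<noteq> u \<longrightarrow> x \<noteq> v \<longrightarrow> u \<noteq> v \<longrightarrow>
        prism_dist u x + prism_dist x v \<noteq> prism_dist u v)"
proof -
  interpret P: pair_graph "complementary_prism G"
    by (rule pair_graph_complementary_prism) (rule pair_graph_axioms)
  have "graph_dist (complementary_prism G) u v \<noteq> \<infinity> \<and>
        graph_dist (complementary_prism G) u x + graph_dist (complementary_prism G) x v =
        graph_dist (complementary_prism G) u v \<longleftrightarrow>
      prism_dist u x + prism_dist x v = prism_dist u v"
    if "S \<subseteq> pverts (complementary_prism G)" "x \<in> S" "u \<in> S" "v \<in> S" for x u v
    using that by (simp add: graph_dist_prism subset_iff flip: of_nat_add)
  then show ?thesis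
    unfolding P.general_position_set_iff pverts_prism by blast
qed

lemma general_position_prismD:
  assumes "general_position_set (complementary_prism G) S"
    and "u \<in> S" "x \<in> S" "v \<in> S" "x \<noteq> u" "x \<noteq> v" "u \<noteq> v"
  shows "prism_dist u x + prism_dist x v \<noteq> prism_dist u v"
  using assms unfolding general_position_set_prism_iff by blast

section \<open>The upper bound n + 1\<close>

lemma finite_general_position_cards:
  "finite {card S | S. general_position_set G S}"
proof -
  have "{card S | S. general_position_set G S} \<subseteq> card ` Pow (pverts G)"
    by (auto simp: general_position_set_def)
  then show ?thesis by (rule finite_subset) simp
qed

lemma card_le_gp: "general_position_set G S \<Longrightarrow> card S \<le> gp G"
  unfolding gp_def by (rule Max_ge[OF finite_general_position_cards]) blast

lemma gp_attained: obtains S where "general_position_set G S" "card S = gp G"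
proof -
  have "general_position_set G {}" by (simp add: general_position_set_def)
  then have "{card S | S. general_position_set G S} \<noteq> {}" by blast
  then have "gp G \<in> {card S | S. general_position_set G S}"
    unfolding gp_def by (rule Max_in[OF finite_general_position_cards])
  then show thesis using that by auto
qed

text \<open>Separates the vertices occurring at all, at most n, from those occurring with both
  copies, at most one in general position.\<close>

lemma card_prism_set:
  assumes "S \<subseteq> pverts G <+> pverts G"
  shows "card S = card (Inl -` S \<union> Inr -` S) + card (Inl -` S \<inter> Inr -` S)"
proof -
  have "Inl -` S \<subseteq> pverts G" "Inr -` S \<subseteq> pverts G" using assms by auto
  then have fin: "finite (Inl -` S)" "finite (Inr -` S)"
    by (auto elim: finite_subset)
  have "x \<in> S \<longleftrightarrow> x \<in> Inl -` S <+> Inr -` S" for x by (cases x) auto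
  then have "S = Inl -` S <+> Inr -` S" by blast
  then have "card S = card (Inl -` S) + card (Inr -` S)"
    using fin card_Plus by metis
  then show ?thesis using card_Un_Int[OF fin] by simp
qed

lemma doubled_unique:
  assumes "general_position_set (complementary_prism G) S"
    and "Inl u \<in> S" "Inr u \<in> S" "Inl v \<in> S" "Inr v \<in> S"
  shows "u = v"
proof (rule ccontr)
  assume "u \<noteq> v"
  \<comment> \<open>For nonadjacent u and v the first sum is 1 + 1, for adjacent ones the second is,
    and the distance on the right is 2.\<close>
  have "prism_dist (Inl u) (Inr u) + prism_dist (Inr u) (Inr v) \<noteq> prism_dist (Inl u) (Inr v)"
    "prism_dist (Inl u) (Inl v) + prism_dist (Inl v) (Inr v) \<noteq> prism_dist (Inl u) (Inr v)"
    by (rule general_position_prismD[OF assms(1)]; use assms \<open>u \<noteq> v\<close> in simp)+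
  with \<open>u \<noteq> v\<close> show False by (auto split: if_splits)
qed

lemma card_prism_general_position_le:
  assumes "general_position_set (complementary_prism G) S"
  shows "card S \<le> card (pverts G) + 1"
proof -
  have S: "S \<subseteq> pverts G <+> pverts G" using assms by (simp only: general_position_set_prism_iff)
  have "Inl -` S \<subseteq> pverts G" "Inr -` S \<subseteq> pverts G" using S by auto
  then have "card (Inl -` S \<union> Inr -` S) \<le> card (pverts G)" "finite (Inl -` S)"
    by (auto intro!: card_mono elim: finite_subset)
  moreover from this(2) have "card (Inl -` S \<inter> Inr -` S) \<le> 1"
    unfolding One_nat_def using doubled_unique[OF assms]
    by (subst card_le_Suc0_iff_eq) auto
  ultimately show ?thesis using card_prism_set[OF S] by linarith
qed

section \<open>Connectedness, eccentricity, radius and center\<close>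

text \<open>Symmetry of the arcs turns connectedness into reachability, and membership in X
  propagates along the arcs.\<close>

lemma connected_closed_set:
  assumes "connected (with_proj G)" "w \<in> X" "w \<in> pverts G" "v \<in> pverts G"
    and closed: "\<And>x y. x \<in> X \<Longrightarrow> (x, y) \<in> parcs G \<Longrightarrow> y \<in> X"
  shows "v \<in> X"
proof -
  have "strongly_connected (with_proj G)"
    using symmetric_connected_imp_strongly_connected[OF sym_arcs assms(1)] .
  then have "w \<rightarrow>\<^sup>*\<^bsub>with_proj G\<^esub> v"
    using assms(3,4) by (simp add: strongly_connected_def)
  then show ?thesis
    by (induction rule: reachable_induct) (use assms(2) closed in auto)
qed

text \<open>Without a neighbour of v the set {v} would be closed under adjacency and hence contain
  w.\<close>

lemma connected_has_neighbour:
  assumes "connected (with_proj G)" "v \<in> pverts G" "w \<in> pverts G" "v \<noteq> w"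
  obtains x where "(v, x) \<in> parcs G"
  using connected_closed_set[OF assms(1), of v "{v}" w] assms by auto

lemma ecc_le_iff: "u \<in> pverts G \<Longrightarrow> ecc G u \<le> c \<longleftrightarrow> (\<forall>v\<in>pverts G. graph_dist G u v \<le> c)"
  unfolding ecc_def by (subst Max_le_iff) auto

lemma rad_le_ecc: "u \<in> pverts G \<Longrightarrow> rad G \<le> ecc G u"
  unfolding rad_def by (intro Min_le) auto

lemma rad_attained:
  assumes "pverts G \<noteq> {}"
  obtains u where "u \<in> pverts G" "rad G = ecc G u"
proof -
  have "rad G \<in> {ecc G u | u. u \<in> pverts G}"
    unfolding rad_def using assms by (intro Min_in) auto
  then show thesis using that by blast
qed

text \<open>A vertex of eccentricity below 2 is adjacent to all others, so each other vertex has
  eccentricity at most 2 through it. This yields two adjacent vertices of eccentricity at most 2, so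
  the right-hand side rules out a radius below 2.\<close>

lemma rad_eq_2_and_center_independent_iff:
  assumes "pverts G \<noteq> {}" "card (pverts G) \<noteq> 1"
  shows "rad G = ereal 2 \<and> independent_set G (center G) \<longleftrightarrow>
    (\<exists>w\<in>pverts G. ecc G w \<le> ereal 2) \<and>
    (\<forall>u v. (u, v) \<in> parcs G \<longrightarrow> \<not> (ecc G u \<le> ereal 2 \<and> ecc G v \<le> ereal 2))"
  (is "?L \<longleftrightarrow> (\<exists>w\<in>_. ?near w) \<and> ?indep")
proof -
  \<comment> \<open>With radius 2 no eccentricity is smaller, so the bound 2 already means
    equality.\<close>
  have center: "center G = {v \<in> pverts G. ecc G v \<le> ereal 2}" if "rad G = ereal 2"
    using rad_le_ecc by (auto simp: center_def that antisym)
  have rad: "rad G = ereal 2" if w: "w \<in> pverts G" "?near w" and indep: ?indep for w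
  proof (rule antisym)
    show "rad G \<le> ereal 2" using rad_le_ecc[OF w(1)] w(2) by (rule order_trans)
    show "ereal 2 \<le> rad G"
    proof (rule ccontr)
      assume less: "\<not> ereal 2 \<le> rad G"
      obtain u where u: "u \<in> pverts G" "rad G = ecc G u" using rad_attained[OF assms(1)] .
      have le1: "graph_dist G u v \<le> 1" if "v \<in> pverts G" for v
      proof -
        have "graph_dist G u v \<le> ecc G u" using ecc_le_iff[OF u(1), of "ecc G u"] that by simp
        then have "graph_dist G u v < ereal 2" using less unfolding u(2) by simp
        then show ?thesis
          by (cases u v rule: graph_dist_cases) (simp_all add: one_ereal_def)
      qed
      \<comment> \<open>The exclusion of the one-vertex graph enters here.\<close>
      have "\<exists>v\<in>pverts G. v \<noteq> u"
      proof (rule ccontr)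
        assume "\<not> (\<exists>v\<in>pverts G. v \<noteq> u)"
        then have "pverts G = {u}" using u(1) by blast
        then show False using assms(2) by simp
      qed
      then obtain v where v: "v \<in> pverts G" "v \<noteq> u" by blast
      have adj: "(u, x) \<in> parcs G" if "x \<in> pverts G" "x \<noteq> u" for x
        using le1[OF that(1)] that(2) by (auto simp: graph_dist_le_1_iff)
      have "?near u" using less u(2) by simp
      moreover have "?near v"
      proof (subst ecc_le_iff[OF v(1)], intro ballI)
        fix x assume x: "x \<in> pverts G"
        show "graph_dist G v x \<le> ereal 2"
          unfolding graph_dist_le_2_iff using adj[OF v] adj[OF x] arcs_symmetric by blast
      qed
      ultimately show False using indep adj[OF v] by blast
    qed
  qed
  show ?thesis
  proof
    assume L: ?L
    then obtain u where "u \<in> pverts G" "rad G = ecc G u" using rad_attained[OF assms(1)] by metis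
    with L have "?near u" by simp
    with \<open>u \<in> pverts G\<close> have "\<exists>w\<in>pverts G. ?near w" by blast
    moreover have ?indep
    proof (intro allI impI notI)
      fix u v assume uv: "(u, v) \<in> parcs G" "?near u \<and> ?near v"
      then have "u \<in> center G" "v \<in> center G"
        using L center in_arcsD1 in_arcsD2 by simp_all
      then show False using L uv(1) by (simp add: independent_set_def)
    qed
    ultimately show "(\<exists>w\<in>pverts G. ?near w) \<and> ?indep" ..
  next
    assume "(\<exists>w\<in>pverts G. ?near w) \<and> ?indep"
    then have "rad G = ereal 2" and indep: ?indep using rad by blast+
    moreover have "independent_set G (center G)"
      unfolding independent_set_def center[OF \<open>rad G = ereal 2\<close>] using indep by blast
    ultimately show ?L by simp
  qed
qed

section \<open>Bipartite graphs and the construction of general position sets\<close>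

lemma bipartition_commute: "bipartition G A B \<longleftrightarrow> bipartition G B A"
  by (auto simp: bipartition_def)

lemma bipartition_arcD:
  assumes "bipartition G A B" "(u, v) \<in> parcs G"
  shows "u \<in> A \<longleftrightarrow> v \<in> B" "u \<in> B \<longleftrightarrow> v \<in> A"
  using assms by (auto simp: bipartition_def)

text \<open>Walks between different parts have odd length, so distance at most 2 from w to B means
  adjacency. Conversely, each other vertex of A has a neighbour, which lies in B and is then
  adjacent to w.\<close>

lemma ecc_le_2_iff:
  assumes conn: "connected (with_proj G)" and bip: "bipartition G A B" and w: "w \<in> A"
  shows "ecc G w \<le> ereal 2 \<longleftrightarrow> (\<forall>b\<in>B. (w, b) \<in> parcs G)"
proof -
  have V: "pverts G = A \<union> B" "A \<inter> B = {}" using bip by (auto simp: bipartition_def)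
  note arcD = bipartition_arcD[OF bip]
  have B: "graph_dist G w b \<le> ereal 2 \<longleftrightarrow> (w, b) \<in> parcs G" if "b \<in> B" for b
    using that w V arcD by (auto simp: graph_dist_le_2_iff)
  have A: "graph_dist G w a \<le> ereal 2" if adj: "\<forall>b\<in>B. (w, b) \<in> parcs G" and a: "a \<in> A" for a
  proof (cases "a = w")
    case False
    then obtain b where "(a, b) \<in> parcs G"
      using connected_has_neighbour[OF conn, of a w] w a V by auto
    moreover from this have "b \<in> B" using arcD a by blast
    ultimately show ?thesis using adj arcs_symmetric by (auto simp: graph_dist_le_2_iff)
  qed (use w V in \<open>auto simp: graph_dist_le_2_iff\<close>)
  show ?thesis
    using ecc_le_iff[of w "ereal 2"] A B w V by auto
qed

lemma prism_dist_commute: "prism_dist x y = prism_dist y x"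
proof -
  have sym: "(u, v) \<in> parcs G \<longleftrightarrow> (v, u) \<in> parcs G" for u v using arcs_symmetric by blast
  show ?thesis
  proof (cases x; cases y)
    fix u v assume "x = Inl u" "y = Inl v"
    moreover have "(\<exists>w. (u, w) \<in> parcs G \<and> (w, v) \<in> parcs G) \<longleftrightarrow>
        (\<exists>w. (v, w) \<in> parcs G \<and> (w, u) \<in> parcs G)"
      using sym by blast
    ultimately show ?thesis using sym[of u v] by simp
  next
    fix u v assume "x = Inr u" "y = Inr v"
    moreover have "(\<exists>w\<in>pverts G. w \<noteq> u \<and> w \<noteq> v \<and> (u, w) \<notin> parcs G \<and> (w, v) \<notin> parcs G) \<longleftrightarrow>
        (\<exists>w\<in>pverts G. w \<noteq> v \<and> w \<noteq> u \<and> (v, w) \<notin> parcs G \<and> (w, u) \<notin> parcs G)"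
      using sym by blast
    ultimately show ?thesis using sym[of u v] by simp
  qed simp_all
qed

lemma prism_dist_pos: "x \<noteq> y \<Longrightarrow> 1 \<le> prism_dist x y"
  by (cases "(x, y)" rule: prism_dist.cases) auto

text \<open>
  Reduces general position of a union to conditions inside the two halves; only vertices that
  occur with both of their copies make the halves interact.
\<close>

lemma general_position_prismI:
  assumes sub: "L \<subseteq> pverts G" "R \<subseteq> pverts G"
    and L: "\<And>a a'. a \<in> L \<Longrightarrow> a' \<in> L \<Longrightarrow> (a, a') \<notin> parcs G"
    and R: "\<And>r r'. r \<in> R \<Longrightarrow> r' \<in> R \<Longrightarrow> prism_dist (Inr r) (Inr r') \<le> 2"
    and RR: "\<And>r s t. r \<in> R \<Longrightarrow> s \<in> R \<Longrightarrow> t \<in> R \<Longrightarrow> s \<noteq> r \<Longrightarrow> s \<noteq> t \<Longrightarrow> r \<noteq> t \<Longrightarrow>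
        prism_dist (Inr r) (Inr s) + prism_dist (Inr s) (Inr t) \<noteq> prism_dist (Inr r) (Inr t)"
    and LR: "\<And>w a. w \<in> L \<inter> R \<Longrightarrow> a \<in> L \<Longrightarrow> prism_dist (Inl w) (Inl a) \<le> 2"
    and RL: "\<And>w r. w \<in> L \<inter> R \<Longrightarrow> r \<in> R \<Longrightarrow> r \<noteq> w \<Longrightarrow> 2 \<le> prism_dist (Inr w) (Inr r)"
  shows "general_position_set (complementary_prism G) (Inl ` L \<union> Inr ` R)"
  unfolding general_position_set_prism_iff
proof (intro conjI ballI impI)
  \<comment> \<open>L is independent, so distinct originals are at distance 2 or 3.\<close>
  have LL: "2 \<le> prism_dist (Inl a) (Inl a')" "prism_dist (Inl a) (Inl a') \<le> 3"
    if "a \<in> L" "a' \<in> L" "a \<noteq> a'" for a a'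
    using that L[of a a'] by auto
  have mix: "1 \<le> prism_dist (Inl a) (Inr r)" "prism_dist (Inl a) (Inr r) \<le> 2"
      "prism_dist (Inl a) (Inr r) = 1 \<longleftrightarrow> a = r"
    for a r by auto
  \<comment> \<open>The distance is at most 2, so an inner vertex would have to be at distance 1
    from both ends. Two originals are never that close, and an inner copy would have to be that of
    a, which \<open>RL\<close> keeps away from the copy of r.\<close>
  have across: "prism_dist (Inl a) x + prism_dist x (Inr r) \<noteq> prism_dist (Inl a) (Inr r)"
    if "a \<in> L" "r \<in> R" "x \<in> Inl ` L \<union> Inr ` R" "x \<noteq> Inl a" "x \<noteq> Inr r" for a r x
  proof (cases x)
    case (Inl b)
    with that show ?thesis using LL[of a b] mix[of a r] mix[of b r] by auto
  next
    case (Inr s)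
    with that have s: "s \<in> R" "s \<noteq> r" by auto
    then have "1 \<le> prism_dist (Inr s) (Inr r)" by (intro prism_dist_pos) simp
    moreover have "2 \<le> prism_dist (Inr s) (Inr r)" if "a = s"
      using RL[of s r] s that \<open>a \<in> L\<close> \<open>r \<in> R\<close> by auto
    ultimately show ?thesis using mix[of a s] mix[of a r] Inr by (cases "a = s") auto
  qed
  fix x u v
  assume S: "x \<in> Inl ` L \<union> Inr ` R" "u \<in> Inl ` L \<union> Inr ` R" "v \<in> Inl ` L \<union> Inr ` R"
    and ne: "x \<noteq> u" "x \<noteq> v" "u \<noteq> v"
  show "prism_dist u x + prism_dist x v \<noteq> prism_dist u v"
  proof (cases u; cases v)
    fix a r assume uv: "u = Inl a" "v = Inr r"
    then show ?thesis using across[of a r x] S ne by auto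
  next
    fix r a assume uv: "u = Inr r" "v = Inl a"
    then have "prism_dist v x + prism_dist x u \<noteq> prism_dist v u" using across[of a r x] S ne by auto
    then show ?thesis using prism_dist_commute by (metis add.commute)
  next
    fix a b assume uv: "u = Inl a" "v = Inl b"
    then have ab: "a \<in> L" "b \<in> L" "a \<noteq> b" using S ne by auto
    show ?thesis
    proof (cases x)
      case (Inl c)
      then have "c \<in> L" "c \<noteq> a" "c \<noteq> b" using S ne uv by auto
      then show ?thesis using LL[of a c] LL[of c b] LL[of a b] ab uv Inl
        by (auto simp del: prism_dist.simps)
    next
      case (Inr r)
      then have r: "r \<in> R" using S by auto
      \<comment> \<open>A detour through a copy has length at least 3, and exactly 3 only if it is
        the copy of an end. That end is then doubled, and \<open>LR\<close> makes the direct
        distance smaller.\<close>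
      have "prism_dist (Inl a) (Inl b) \<le> 2" if "r = a \<or> r = b"
        using that LR[of a b] LR[of b a] ab r prism_dist_commute[of "Inl b" "Inl a"]
        by (auto simp del: prism_dist.simps)
      then show ?thesis
        using LL[OF ab] mix[of a r] mix[of b r] ab uv Inr prism_dist_commute[of "Inr r" "Inl b"]
        by (cases "r = a"; cases "r = b"; simp del: prism_dist.simps(1))
    qed
  next
    \<comment> \<open>An original is at distance 1 from at most one of two copies, so a detour
      through it has length at least 3, against the bound 2 of \<open>R\<close>.\<close>
    fix r s assume uv: "u = Inr r" "v = Inr s"
    then have rs: "r \<in> R" "s \<in> R" "r \<noteq> s" using S ne by auto
    show ?thesis
    proof (cases x)
      case (Inl a)
      then show ?thesis
        using mix[of a r] mix[of a s] R[OF rs(1,2)] rs(3) uv by (auto simp del: prism_dist.simps(2))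
    next
      case (Inr t)
      then show ?thesis using RR[of r t s] rs S ne uv by (auto simp del: prism_dist.simps)
    qed
  qed
qed (use sub in auto)

text \<open>The lower bound n: the copies of the independent set B form a clique in the complement,
  and as A and B are disjoint no vertex is doubled.\<close>

lemma general_position_parts:
  assumes bip: "bipartition G A B"
  shows "general_position_set (complementary_prism G) (Inl ` A \<union> Inr ` B)"
proof -
  have V: "pverts G = A \<union> B" "A \<inter> B = {}" using bip by (auto simp: bipartition_def)
  have indep: "(u, v) \<notin> parcs G" if "u \<in> A \<and> v \<in> A \<or> u \<in> B \<and> v \<in> B" for u v
    using bipartition_arcD[OF bip, of u v] V that by auto
  then have "prism_dist (Inr r) (Inr s) = (if r = s then 0 else 1)" if "r \<in> B" "s \<in> B" for r s
    using that by simp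
  then show ?thesis
    by (intro general_position_prismI) (use V indep in \<open>auto simp del: prism_dist.simps\<close>)
qed

text \<open>Only w is doubled. Its adjacency to B keeps it within distance 2 of A, and the missing
  arcs between B and A keep its copy at distance 2 from the copies of B.\<close>

lemma general_position_parts_insert:
  assumes conn: "connected (with_proj G)" and bip: "bipartition G A B"
    and w: "w \<in> A" "\<forall>b\<in>B. (w, b) \<in> parcs G"
    and B: "\<forall>b\<in>B. \<exists>a\<in>A. (b, a) \<notin> parcs G"
  shows "general_position_set (complementary_prism G) (Inl ` A \<union> Inr ` insert w B)"
proof -
  have V: "pverts G = A \<union> B" "A \<inter> B = {}" using bip by (auto simp: bipartition_def)
  have indep: "(u, v) \<notin> parcs G" if "u \<in> A \<and> v \<in> A \<or> u \<in> B \<and> v \<in> B" for u v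
    using bipartition_arcD[OF bip, of u v] V that by auto
  have wA: "prism_dist (Inl w) (Inl a) \<le> 2" if a: "a \<in> A" for a
  proof (cases "a = w")
    case False
    then obtain x where x: "(a, x) \<in> parcs G"
      using connected_has_neighbour[OF conn, of a w] w(1) a V by auto
    moreover from this have "x \<in> B" using bipartition_arcD[OF bip] a by blast
    ultimately have "\<exists>x. (w, x) \<in> parcs G \<and> (x, a) \<in> parcs G"
      using w(2) arcs_symmetric by blast
    then show ?thesis by simp
  qed simp
  have wB: "prism_dist (Inr w) (Inr b) = 2" if b: "b \<in> B" for b
  proof -
    \<comment> \<open>The copy of this a is a common neighbour of the copies of w and b.\<close>
    obtain a where a: "a \<in> A" "(b, a) \<notin> parcs G" using B b by blast
    have "\<exists>x\<in>pverts G. x \<noteq> w \<and> x \<noteq> b \<and> (w, x) \<notin> parcs G \<and> (x, b) \<notin> parcs G"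
    proof (intro bexI[of _ a] conjI)
      show "a \<in> pverts G" using a V by blast
      show "a \<noteq> w" using a w(2) b arcs_symmetric by blast
      show "a \<noteq> b" using a b V by blast
      show "(w, a) \<notin> parcs G" using indep w(1) a(1) by simp
      show "(a, b) \<notin> parcs G" using a(2) arcs_symmetric by blast
    qed
    moreover have "(w, b) \<in> parcs G" "w \<noteq> b" using w b V by auto
    ultimately show ?thesis by simp
  qed
  \<comment> \<open>No three such copies are in line: the possible equations 1 + 1 = 1, 2 + 1 = 2
    and 2 + 2 = 1 all fail.\<close>
  have BB: "prism_dist (Inr r) (Inr s) = (if r = s then 0 else if r = w \<or> s = w then 2 else 1)"
    if "r \<in> insert w B" "s \<in> insert w B" for r s
  proof -
    have "prism_dist (Inr r) (Inr s) = 1" if "r \<in> B" "s \<in> B" "r \<noteq> s"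
      using that indep[of r s] by simp
    moreover have "prism_dist (Inr r) (Inr r) = 0" by simp
    ultimately show ?thesis
      using that wB[of r] wB[of s] prism_dist_commute[of "Inr r" "Inr w"] w(1) V
      by (auto simp del: prism_dist.simps)
  qed
  have "A \<inter> insert w B = {w}" using V w(1) by auto
  then show ?thesis
    using V w(1) indep wA BB
    by (intro general_position_prismI) (auto simp del: prism_dist.simps)
qed

section \<open>The structure of general position sets of size n + 1\<close>

lemma card_prism_union:
  assumes "finite L" "finite R"
  shows "card (Inl ` L \<union> Inr ` R) = card L + card R"
  using card_Plus[OF assms] by (simp add: Plus_def)

text \<open>The bounds n on \<open>card U\<close> and 1 on \<open>card D\<close> must both be
  attained.\<close>

lemma general_position_prism_maximal:
  assumes S: "general_position_set (complementary_prism G) S"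
    and card: "card (pverts G) + 1 \<le> card S"
  obtains w where "w \<in> pverts G" "Inl w \<in> S" "Inr w \<in> S"
    "\<And>u. u \<in> pverts G \<Longrightarrow> Inl u \<in> S \<or> Inr u \<in> S"
proof -
  have sub: "S \<subseteq> pverts G <+> pverts G" using S by (simp only: general_position_set_prism_iff)
  define U where "U = Inl -` S \<union> Inr -` S"
  define D where "D = Inl -` S \<inter> Inr -` S"
  have UD: "card S = card U + card D" using card_prism_set[OF sub] by (simp only: U_def D_def)
  have U: "U \<subseteq> pverts G" using sub by (auto simp: U_def)
  have "D \<subseteq> U" by (auto simp: D_def U_def)
  then have "finite D" using U by (meson finite_subset finite_verts)
  have "card D \<le> 1"
    unfolding One_nat_def card_le_Suc0_iff_eq[OF \<open>finite D\<close>]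
    using doubled_unique[OF S] by (simp add: D_def)
  moreover have "card U \<le> card (pverts G)" using U by (intro card_mono) simp_all
  ultimately have "card U = card (pverts G)" "card D \<noteq> 0" using UD card by linarith+
  then have "U = pverts G" and "D \<noteq> {}"
    using card_subset_eq[OF finite_verts U] by (blast, fastforce)
  then obtain w where "w \<in> D" by blast
  show thesis
  proof (rule that[of w])
    show "w \<in> pverts G" using \<open>w \<in> D\<close> \<open>D \<subseteq> U\<close> U by blast
    show "Inl w \<in> S" "Inr w \<in> S" using \<open>w \<in> D\<close> by (simp_all add: D_def)
    show "Inl u \<in> S \<or> Inr u \<in> S" if "u \<in> pverts G" for u
      using that unfolding \<open>U = pverts G\<close>[symmetric] by (simp add: U_def)
  qed
qed

text \<open>The converse of \<open>general_position_parts_insert\<close>: the conclusions are the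
  conditions on w and B assumed there.\<close>

lemma doubled_vertex_dominates:
  assumes conn: "connected (with_proj G)" and bip: "bipartition G A B"
    and S: "general_position_set (complementary_prism G) S"
    and w: "w \<in> A" "Inl w \<in> S" "Inr w \<in> S"
    and cover: "\<And>u. u \<in> pverts G \<Longrightarrow> Inl u \<in> S \<or> Inr u \<in> S"
  shows "\<forall>b\<in>B. (w, b) \<in> parcs G" and "\<forall>b\<in>B. \<exists>a\<in>A. (b, a) \<notin> parcs G"
proof -
  have V: "pverts G = A \<union> B" "A \<inter> B = {}" using bip by (auto simp: bipartition_def)
  note gpD = general_position_prismD[OF S]
  \<comment> \<open>Otherwise w would be the middle of the geodesic from u through w to the copy of
    w.\<close>
  have near: "Inr u \<in> S" if u: "(w, u) \<in> parcs G" for u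
  proof -
    have "Inl u \<notin> S"
    proof
      assume "Inl u \<in> S"
      moreover have "u \<noteq> w" using u no_loops' by blast
      ultimately show False
        using gpD[of "Inl u" "Inl w" "Inr w"] w u arcs_symmetric[OF u] by simp
    qed
    then show ?thesis using cover u in_arcsD2 by blast
  qed
  \<comment> \<open>Otherwise the copy of w would be the middle of a geodesic from w to the copy of
    u.\<close>
  have far: "Inl u \<in> S" if u: "(w, u) \<notin> parcs G" "u \<in> pverts G" for u
  proof (cases "u = w")
    case False
    have "Inr u \<notin> S"
      using gpD[of "Inl w" "Inr w" "Inr u"] False u(1) w by auto
    then show ?thesis using cover u(2) by blast
  qed (use w in simp)
  text \<open>The ball of radius 2 around w is closed under adjacency.\<close>
  have closed: "y \<in> {w} \<union> {b. (w, b) \<in> parcs G} \<union> {a. \<exists>b. (w, b) \<in> parcs G \<and> (b, a) \<in> parcs G}"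
    if x: "x \<in> {w} \<union> {b. (w, b) \<in> parcs G} \<union> {a. \<exists>b. (w, b) \<in> parcs G \<and> (b, a) \<in> parcs G}"
      and xy: "(x, y) \<in> parcs G" for x y
  proof (rule ccontr)
    assume y: "\<not> ?thesis"
    have "x \<noteq> w" "(w, x) \<notin> parcs G" using y xy by auto
    then obtain b where b: "(w, b) \<in> parcs G" "(b, x) \<in> parcs G" using x by auto
    have "b \<in> B" using bipartition_arcD[OF bip b(1)] w(1) by blast
    then have "x \<in> A" using bipartition_arcD[OF bip b(2)] by blast
    then have "y \<in> B" using bipartition_arcD[OF bip xy] by blast
    have wx: "(w, x) \<notin> parcs G" "w \<noteq> x" and wy: "(w, y) \<notin> parcs G" "w \<noteq> y"
      using bipartition_arcD[OF bip, of w x] w(1) V \<open>x \<in> A\<close> xy y by auto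
    have no_mid: "\<nexists>z. (w, z) \<in> parcs G \<and> (z, y) \<in> parcs G"
      using y by auto
    have "x \<noteq> y" using xy no_loops' by blast
    \<comment> \<open>Neither x nor y is adjacent to w, so both occur as originals, although x lies
      on a geodesic of length 3 from w to y.\<close>
    have "Inl x \<in> S" "Inl y \<in> S" using far wx wy xy in_arcsD1 in_arcsD2 by blast+
    moreover have "prism_dist (Inl w) (Inl x) = 2" using wx b by auto
    moreover have "prism_dist (Inl w) (Inl y) = 3" using wy no_mid by simp
    moreover have "prism_dist (Inl x) (Inl y) = 1" using \<open>x \<noteq> y\<close> xy by simp
    ultimately show False
      using gpD[of "Inl w" "Inl x" "Inl y"] w(2) wx(2) wy(2) \<open>x \<noteq> y\<close>
      by (simp del: prism_dist.simps)
  qed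
  show adj: "\<forall>b\<in>B. (w, b) \<in> parcs G"
  proof
    fix b assume b: "b \<in> B"
    have "b \<in> {w} \<union> {b. (w, b) \<in> parcs G} \<union> {a. \<exists>b. (w, b) \<in> parcs G \<and> (b, a) \<in> parcs G}"
      by (rule connected_closed_set[OF conn _ _ _ closed]) (use w(1) b V in auto)
    moreover have "b \<noteq> w" using w(1) b V by blast
    \<comment> \<open>By parity b is not reached in two steps, which leaves only adjacency to
      w.\<close>
    moreover have "\<not> ((w, c) \<in> parcs G \<and> (c, b) \<in> parcs G)" for c
      using bipartition_arcD[OF bip, of w c] bipartition_arcD[OF bip, of c b] w(1) b V by blast
    ultimately show "(w, b) \<in> parcs G" by blast
  qed
  show "\<forall>b\<in>B. \<exists>a\<in>A. (b, a) \<notin> parcs G"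
  proof (rule ccontr)
    assume "\<not> ?thesis"
    then obtain b where b: "b \<in> B" "\<And>a. a \<in> A \<Longrightarrow> (b, a) \<in> parcs G" by blast
    have wb: "(w, b) \<in> parcs G" "w \<noteq> b" using adj b(1) w(1) V by blast+
    \<comment> \<open>Every vertex of B is adjacent to w and every vertex of A to b, so the copies
      of w and b have no common neighbour; the geodesic of length 3 through w and b then has w as an
      inner vertex.\<close>
    have "\<not> (\<exists>x\<in>pverts G. x \<noteq> w \<and> x \<noteq> b \<and> (w, x) \<notin> parcs G \<and> (x, b) \<notin> parcs G)"
      using adj b(2) V(1) arcs_symmetric by blast
    then have "prism_dist (Inr w) (Inr b) = 3" using wb by simp
    moreover have "Inr b \<in> S" using near wb(1) by blast
    ultimately show False
      using gpD[of "Inr w" "Inl w" "Inr b"] w wb(2) by simp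
  qed
qed

section \<open>The bounds and the characterization of equality\<close>

text \<open>Allows the doubled or near vertex to be placed in the first part.\<close>

lemma bipartition_sideE:
  assumes "bipartition G A B" "w \<in> pverts G"
  obtains A' B' where "bipartition G A' B'" "w \<in> A'"
proof (cases "w \<in> A")
  case True
  then show thesis using assms(1) that by blast
next
  case False
  then have "w \<in> B" using assms by (auto simp: bipartition_def)
  then show thesis using assms(1) that bipartition_commute by blast
qed

lemma card_bipartition:
  assumes "bipartition G A B"
  shows "finite A" "finite B" "card (pverts G) = card A + card B"
proof -
  have V: "pverts G = A \<union> B" "A \<inter> B = {}" using assms by (auto simp: bipartition_def)
  then show fin: "finite A" "finite B" using finite_verts by (metis finite_Un)+
  show "card (pverts G) = card A + card B" using card_Un_disjoint[OF fin V(2)] V(1) by simp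
qed

lemma gp_prism_bounds:
  assumes "bipartition G A B"
  shows "card (pverts G) \<le> gp (complementary_prism G)"
    and "gp (complementary_prism G) \<le> card (pverts G) + 1"
proof -
  interpret P: pair_graph "complementary_prism G"
    by (rule pair_graph_complementary_prism) (rule pair_graph_axioms)
  show "card (pverts G) \<le> gp (complementary_prism G)"
    using P.card_le_gp[OF general_position_parts[OF assms]] card_bipartition[OF assms]
    by (simp add: card_prism_union)
  show "gp (complementary_prism G) \<le> card (pverts G) + 1"
    using P.gp_attained card_prism_general_position_le by metis
qed

text \<open>The right-hand side is that of \<open>rad_eq_2_and_center_independent_iff\<close>, which
  makes the two equivalences compose.\<close>

lemma gp_prism_eq_Suc_iff:
  assumes conn: "connected (with_proj G)" and bip: "bipartition G A B"
  shows "gp (complementary_prism G) = card (pverts G) + 1 \<longleftrightarrow>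
    (\<exists>w\<in>pverts G. ecc G w \<le> ereal 2) \<and>
    (\<forall>u v. (u, v) \<in> parcs G \<longrightarrow> \<not> (ecc G u \<le> ereal 2 \<and> ecc G v \<le> ereal 2))"
  (is "?L \<longleftrightarrow> ?R")
proof -
  interpret P: pair_graph "complementary_prism G"
    by (rule pair_graph_complementary_prism) (rule pair_graph_axioms)
  show ?thesis
  proof
    assume L: ?L
    obtain S where S: "general_position_set (complementary_prism G) S"
        "card S = gp (complementary_prism G)"
      using P.gp_attained .
    then have "card (pverts G) + 1 \<le> card S" using L by simp
    then obtain w where w: "w \<in> pverts G" "Inl w \<in> S" "Inr w \<in> S"
        and cover: "\<And>u. u \<in> pverts G \<Longrightarrow> Inl u \<in> S \<or> Inr u \<in> S"
      using general_position_prism_maximal[OF S(1)] by metis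
    obtain A' B' where bip': "bipartition G A' B'" and wA: "w \<in> A'"
      using bipartition_sideE[OF bip w(1)] .
    note dom = doubled_vertex_dominates[OF conn bip' S(1) wA w(2,3) cover]
    have "ecc G w \<le> ereal 2" using ecc_le_2_iff[OF conn bip' wA] dom(1) by blast
    \<comment> \<open>With the parts exchanged, \<open>ecc_le_2_iff\<close> would make b adjacent to
      all of A'. Since every arc has an end in B', no two adjacent vertices are both near.\<close>
    moreover have far: "\<not> ecc G b \<le> ereal 2" if "b \<in> B'" for b
      using ecc_le_2_iff[OF conn _ that] bip' bipartition_commute dom(2) that by blast
    moreover have "u \<in> B' \<or> v \<in> B'" if "(u, v) \<in> parcs G" for u v
      using bip' that by (auto simp: bipartition_def)
    ultimately show ?R using w(1) by blast
  next
    assume R: ?R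
    then obtain w where w: "w \<in> pverts G" "ecc G w \<le> ereal 2" by blast
    obtain A' B' where bip': "bipartition G A' B'" and wA: "w \<in> A'"
      using bipartition_sideE[OF bip w(1)] .
    have V: "A' \<inter> B' = {}" using bip' by (simp add: bipartition_def)
    have adj: "\<forall>b\<in>B'. (w, b) \<in> parcs G" using ecc_le_2_iff[OF conn bip' wA] w(2) by blast
    have "\<forall>b\<in>B'. \<exists>a\<in>A'. (b, a) \<notin> parcs G"
    proof
      fix b assume b: "b \<in> B'"
      \<comment> \<open>b is adjacent to w, which is near.\<close>
      then have "\<not> ecc G b \<le> ereal 2" using adj R w(2) by blast
      then show "\<exists>a\<in>A'. (b, a) \<notin> parcs G"
        using ecc_le_2_iff[OF conn _ b] bip' bipartition_commute by blast
    qed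
    from P.card_le_gp[OF general_position_parts_insert[OF conn bip' wA adj this]]
    have "card A' + card (insert w B') \<le> gp (complementary_prism G)"
      using card_bipartition[OF bip'] by (simp only: card_prism_union finite_insert)
    \<comment> \<open>This makes the inserted copy of w count as the additional vertex.\<close>
    moreover have "w \<notin> B'" using wA V by blast
    ultimately have "card (pverts G) + 1 \<le> gp (complementary_prism G)"
      using card_bipartition[OF bip'] by simp
    then show ?L using gp_prism_bounds(2)[OF bip] by (rule antisym[rotated])
  qed
qed

end

theorem theorem5p1:
  fixes G :: "'a pair_pre_digraph" and A B :: "'a set"
  assumes "pair_graph G" and "connected (with_proj G)" and "bipartition G A B"
  shows "card (pverts G) \<le> gp (complementary_prism G)
    \<and> gp (complementary_prism G) \<le> card (pverts G) + 1
    \<and> (card (pverts G) \<noteq> 1 \<longrightarrow>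
        (gp (complementary_prism G) = card (pverts G) + 1 \<longleftrightarrow>
           rad G = 2 \<and> independent_set G (center G)))"
proof -
  interpret pair_graph G by fact
  \<comment> \<open>Strong connectedness includes the existence of a vertex.\<close>
  have "pverts G \<noteq> {}"
    using assms(2) symmetric_connected_imp_strongly_connected[OF sym_arcs]
    by (auto simp: strongly_connected_def)
  then have "card (pverts G) \<noteq> 1 \<longrightarrow>
      (gp (complementary_prism G) = card (pverts G) + 1 \<longleftrightarrow>
         rad G = ereal 2 \<and> independent_set G (center G))"
    using rad_eq_2_and_center_independent_iff gp_prism_eq_Suc_iff[OF assms(2,3)] by simp
  then show ?thesis
    using gp_prism_bounds[OF assms(3)] by simp
qed

end
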